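(* Let $n$ be a positive integer with $\gcd(2,n)=1$ and let $k=2$. Then for every pair of distinct nonzero $v_1,v_2\in\mathbb{F}_{2^n}$, $$\bigl|\{(x,y,z)\in\Delta^3:\ v_1x+v_2y+(v_1+v_2)z=0\}\bigr|=2^{2n-3}.$$ Equivalently, for all $a,b\in\mathbb{F}_{2^n}\setminus\{0,1\}$ with $a^6+b^6=1$, the degree-$15$ polynomial $(a\tau^5+b)^3+(\tau^3+1)^5$ in $\tau$ has $\tau_0=a/b$ as its unique root in $\mathbb{F}_{2^n}$.
   Context: $\mathbb{F}_{2^n}$ is the field with $2^n$ elements. For $k=2$, $F(x)=x^{4^k-2^k+1}=x^{13}$ on $\mathbb{F}_{2^n}$, $\delta(b)=F(b)+F(b+1)+1$, and $\Delta=\{\delta(b): b\in\mathbb{F}_{2^n}\}$. *)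

theory Defs
  imports "HOL-Computational_Algebra.Polynomial" "HOL-Library.Cardinality"
begin

text \<open>
  A field with \<open>2 ^ n\<close> elements is a type \<open>'a :: {field, finite}\<close> with
  \<open>CARD('a) = 2 ^ n\<close>; this determines the field up to isomorphism.
\<close>

definition kasami :: "nat \<Rightarrow> 'a :: field \<Rightarrow> 'a" where
  "kasami k x = x ^ (4 ^ k - 2 ^ k + 1)"

lemma kasami_2: "kasami 2 x = x ^ 13"
  by (simp add: kasami_def)

definition kasami_delta :: "nat \<Rightarrow> 'a :: field \<Rightarrow> 'a" where
  "kasami_delta k b = kasami k b + kasami k (b + 1) + 1"

definition kasami_Delta :: "nat \<Rightarrow> 'a :: field set" where
  "kasami_Delta k = range (kasami_delta k)"

definition tau_poly :: "'a :: field \<Rightarrow> 'a \<Rightarrow> 'a poly" where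
  "tau_poly a b = (monom a 5 + [:b:]) ^ 3 + (monom 1 3 + 1) ^ 5"

end

theory Submission
  imports Defs
begin

text \<open>
  Write \<open>q = 2 ^ n\<close>. One has \<open>\<delta>(b) = g(b\<^sup>2 + b + 1)\<close> for \<open>g(t) = t\<^sup>6 + t\<^sup>5\<close>. Every fibre of \<open>g\<close> on the
  field consists of exactly two points, one of each trace, so \<open>\<Delta>\<close> is the whole range of \<open>g\<close>:
  two points of a fibre exist because the Dickson polynomial \<open>x\<^sup>5 + x\<^sup>3 + x\<close> permutes the field, and
  points \<open>s \<noteq> t\<close> of a fibre satisfy \<open>s + t = 1 + z + z\<^sup>2\<close> for some \<open>z\<close>. For \<open>m \<noteq> 0\<close> the substitution
  \<open>x = m t\<^sup>2\<close> turns the character sum of \<open>m\<^sup>3 g(t)\<close> into that of \<open>x\<^sup>3 + m x\<^sup>5\<close>. With \<open>v\<^sub>i = m\<^sub>i\<^sup>3\<close>,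
  orthogonality reduces the count to showing that the character sum of \<open>x\<^sup>3 + y\<^sup>3 + z\<^sup>3\<close> over
  \<open>m\<^sub>1 x\<^sup>5 + m\<^sub>2 y\<^sup>5 + m\<^sub>3 z\<^sup>5 = 0\<close> vanishes; by homogeneity this says that this curve meets the Fermat
  cubic in the single projective point \<open>(m\<^sub>1 : m\<^sub>2 : m\<^sub>3)\<close>, which is also what the uniqueness of the
  root \<open>a / b\<close> expresses. For a point \<open>X\<close> of the cubic, the line \<open>x\<^sub>1\<^sup>5 v\<^sub>1 + x\<^sub>2\<^sup>5 v\<^sub>2 + x\<^sub>3\<^sup>5 v\<^sub>3 = 0\<close> passes
  through \<open>X\<close>, and the quadratic for its other two intersections with the cubic is equivalent to
  \<open>Y\<^sup>2 + Y B + B\<^sup>2 = 0\<close>, which has no nontrivial solution as \<open>n\<close> is odd.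
\<close>

text \<open>Grouping by value. Constant \<open>h\<close> turns this into a count of the range; a
  character \<open>h\<close> moves sums from the range of \<open>g\<close> to the field.\<close>

lemma sum_equal_fibres:
  fixes f :: "'b :: finite \<Rightarrow> 'c" and h :: "'c \<Rightarrow> 'd :: comm_semiring_1"
  assumes "\<And>x. card {y. f y = f x} = k"
  shows "(\<Sum>x\<in>UNIV. h (f x)) = of_nat k * (\<Sum>y\<in>range f. h y)"
proof -
  have "(\<Sum>x\<in>UNIV. h (f x)) = (\<Sum>y\<in>range f. \<Sum>x\<in>{x \<in> UNIV. f x = y}. h (f x))"
    by (rule sum.image_gen) simp
  also have "\<dots> = (\<Sum>y\<in>range f. of_nat k * h y)"
    using assms by (intro sum.cong) auto
  finally show ?thesis by (simp add: sum_distrib_left)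
qed

section \<open>Arithmetic in characteristic 2\<close>

locale odd_binary_field =
  fixes T :: "'a :: {field, finite} itself" and n :: nat
  assumes odd_n: "odd n" and card_UNIV_eq: "CARD('a) = 2 ^ n"
begin

lemma two_eq_0: "(2 :: 'a) = 0"
proof -
  have "of_nat CARD('a) = (0 :: 'a)"
  proof -
    \<comment> \<open>The shift by 1 permutes the field, so it changes the sum of all elements by
      the cardinality, which must vanish.\<close>
    have "(\<Sum>x\<in>(UNIV :: 'a set). x + 1) = (\<Sum>x\<in>UNIV. x)"
      by (rule sum.reindex_bij_witness[of _ "\<lambda>x. x - 1" "\<lambda>x. x + 1"]) auto
    thus ?thesis by (simp add: sum.distrib)
  qed
  hence "(2 :: 'a) ^ n = 0" by (simp add: card_UNIV_eq)
  thus ?thesis by simp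
qed

lemma add_self [simp]: "x + x = (0 :: 'a)"
  using two_eq_0 by (metis mult_2 mult_zero_left)

lemma add_self_left [simp]: "x + (x + y) = (y :: 'a)"
  by (simp flip: add.assoc)

lemma uminus_eq [simp]: "- x = (x :: 'a)"
  by (metis add_self add_eq_0_iff)

lemma diff_eq [simp]: "x - y = (x + y :: 'a)"
  by (metis diff_conv_add_uminus uminus_eq)

lemma numeral_Bit0_eq [simp]: "numeral (num.Bit0 k) = (0 :: 'a)"
  by (simp only: numeral_Bit0 add_self)

lemma numeral_Bit1_eq [simp]: "numeral (num.Bit1 k) = (1 :: 'a)"
  by (simp only: numeral_Bit1 add_self add_0_left)

lemma add_eq_0_iff_eq: "x + y = 0 \<longleftrightarrow> x = (y :: 'a)"
  by (metis add_self add_eq_0_iff uminus_eq)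

lemma power2_add: "(x + y) ^ 2 = x ^ 2 + (y :: 'a) ^ 2"
  by (simp add: power2_eq_square algebra_simps)

lemma power4_add: "(x + y) ^ 4 = x ^ 4 + (y :: 'a) ^ 4"
proof -
  have "(x + y) ^ 4 = ((x + y) ^ 2) ^ 2" by (simp flip: power_mult)
  also have "\<dots> = (x ^ 2) ^ 2 + (y ^ 2) ^ 2" by (simp only: power2_add)
  finally show ?thesis by (simp flip: power_mult)
qed

section \<open>Power maps that permute the field\<close>

text \<open>Multiplication by \<open>x\<close> permutes the nonzero elements, hence preserves their
  product.\<close>

lemma power_pred_card:
  assumes "(x :: 'a) \<noteq> 0"
  shows "x ^ (2 ^ n - 1) = 1"
proof -
  have "(\<Prod>y\<in>UNIV - {0 :: 'a}. x * y) = (\<Prod>y\<in>UNIV - {0}. y)"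
    by (rule prod.reindex_bij_witness[of _ "\<lambda>y. y / x" "\<lambda>y. x * y"]) (use assms in auto)
  hence "x ^ card (UNIV - {0 :: 'a}) = 1"
    by (simp add: prod.distrib)
  thus ?thesis by (simp add: card_Diff_subset card_UNIV_eq)
qed

text \<open>A quotient \<open>w\<close> of two elements with equal powers satisfies
  \<open>w ^ m = 1\<close> and \<open>w ^ (2 ^ n - 1) = 1\<close>; Bezout then gives
  \<open>w = 1\<close>.\<close>

lemma inj_power:
  assumes "coprime m (2 ^ n - 1)" "m > 0"
  shows "inj (\<lambda>x :: 'a. x ^ m)"
proof (rule injI)
  fix x y :: 'a assume eq: "x ^ m = y ^ m"
  show "x = y"
  proof (cases "y = 0")
    case True
    thus ?thesis using eq \<open>m > 0\<close> by (simp add: zero_power)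
  next
    case False
    hence x: "x \<noteq> 0" using eq \<open>m > 0\<close> by (auto simp: power_0_left)
    define w where "w = x / y"
    have wm: "w ^ m = 1"
      unfolding w_def power_divide eq using False by simp
    have wn: "w ^ (2 ^ n - 1) = 1"
      unfolding w_def by (rule power_pred_card) (use x False in simp)
    have "m \<noteq> 0" using assms(2) by simp
    from bezout_nat[OF this, of "2 ^ n - 1"]
    obtain a b where "m * a = (2 ^ n - 1) * b + gcd m (2 ^ n - 1)" by blast
    hence ab: "m * a = (2 ^ n - 1) * b + 1"
      using assms(1) by (simp only: coprime_iff_gcd_eq_1)
    have "1 = w ^ (m * a)" unfolding power_mult wm by simp
    also have "\<dots> = w" unfolding ab power_add power_mult wn by simp
    finally show ?thesis using False by (simp add: w_def)
  qed
qed

text \<open>Oddness of \<open>n\<close> enters here: \<open>2 ^ n = 2 * 4 ^ k\<close>, where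
  \<open>4 ^ k\<close> is 1 modulo 3 and 1 or 4 modulo 5.\<close>

lemma coprime_3: "coprime 3 (2 ^ n - 1 :: nat)" and coprime_5: "coprime 5 (2 ^ n - 1 :: nat)"
proof -
  obtain k where k: "n = 2 * k + 1" using odd_n by (rule oddE)
  have step3: "(4 * m) mod 3 = 1" if "m mod 3 = 1" for m :: nat
    using that by presburger
  have step5: "(4 * m) mod 5 = 1 \<or> (4 * m) mod 5 = 4" if "m mod 5 = 1 \<or> m mod 5 = 4" for m :: nat
    using that by presburger
  have mod3: "(4 :: nat) ^ k mod 3 = 1"
    by (induction k) (simp_all only: power_0 power_Suc step3, simp)
  have mod5: "(4 :: nat) ^ k mod 5 = 1 \<or> (4 :: nat) ^ k mod 5 = 4"
  proof (induction k)
    case (Suc k)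
    show ?case unfolding power_Suc by (rule step5[OF Suc])
  qed simp
  have "\<not> 3 dvd 2 * m - 1" if "m mod 3 = 1" for m :: nat
    using that by presburger
  from this[OF mod3] have "\<not> 3 dvd (2 ^ n - 1 :: nat)" by (simp add: k power_mult)
  thus "coprime 3 (2 ^ n - 1 :: nat)" by (rule prime_imp_coprime[rotated]) simp
  have "\<not> 5 dvd 2 * m - 1" if "m mod 5 = 1 \<or> m mod 5 = 4" for m :: nat
    using that by presburger
  from this[OF mod5] have "\<not> 5 dvd (2 ^ n - 1 :: nat)" by (simp add: k power_mult)
  thus "coprime 5 (2 ^ n - 1 :: nat)" by (rule prime_imp_coprime[rotated]) simp
qed

lemma inj_cube: "inj (\<lambda>x :: 'a. x ^ 3)" and inj_fifth: "inj (\<lambda>x :: 'a. x ^ 5)"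
  by (rule inj_power[OF coprime_3], simp) (rule inj_power[OF coprime_5], simp)

lemma cube_eq_iff: "x ^ 3 = y ^ 3 \<longleftrightarrow> x = (y :: 'a)"
  and fifth_eq_iff: "x ^ 5 = y ^ 5 \<longleftrightarrow> x = (y :: 'a)"
  using inj_eq[OF inj_cube] inj_eq[OF inj_fifth] by auto

lemma square_eq_iff: "x ^ 2 = y ^ 2 \<longleftrightarrow> x = (y :: 'a)"
  by (metis add_eq_0_iff_eq power2_add zero_eq_power2)

lemma bij_cube: "bij (\<lambda>x :: 'a. x ^ 3)" and bij_fifth: "bij (\<lambda>x :: 'a. x ^ 5)"
  and bij_square: "bij (\<lambda>x :: 'a. x ^ 2)"
proof -
  have *: "bij f" if "inj f" for f :: "'a \<Rightarrow> 'a"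
    using that finite_UNIV_inj_surj[OF finite that] by (rule bijI)
  show "bij (\<lambda>x :: 'a. x ^ 3)" by (rule *[OF inj_cube])
  show "bij (\<lambda>x :: 'a. x ^ 5)" by (rule *[OF inj_fifth])
  show "bij (\<lambda>x :: 'a. x ^ 2)"
    by (rule *, rule injI) (simp only: square_eq_iff)
qed

text \<open>Multiplied by \<open>x + y\<close> the form becomes \<open>x ^ 3 + y ^ 3\<close>, so
  injectivity of cubing gives \<open>x = y\<close>, where the form is just
  \<open>x ^ 2\<close>.\<close>

lemma norm_form_eq_0:
  assumes "x ^ 2 + x * y + y ^ 2 = (0 :: 'a)"
  shows "x = 0" "y = 0"
proof -
  have "x ^ 3 + y ^ 3 = (x + y) * (x ^ 2 + x * y + y ^ 2)"
    by (simp add: algebra_simps eval_nat_numeral)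
  hence "x = y" using assms by (simp add: add_eq_0_iff_eq cube_eq_iff)
  thus "x = 0" "y = 0" using assms by (auto simp: power2_eq_square)
qed

lemma square_add_self_neq_1: "x ^ 2 + x + 1 \<noteq> (0 :: 'a)"
  using norm_form_eq_0[of x 1] by auto

section \<open>The trace character\<close>

definition AS :: "'a set" where
  "AS = range (\<lambda>b. b ^ 2 + b)"

lemma AS_add: "x \<in> AS \<Longrightarrow> y \<in> AS \<Longrightarrow> x + y \<in> AS"
proof -
  assume "x \<in> AS" "y \<in> AS"
  then obtain b c where "x = b ^ 2 + b" "y = c ^ 2 + c" by (auto simp: AS_def)
  hence "x + y = (b + c) ^ 2 + (b + c)" by (simp add: power2_add ac_simps)
  thus "x + y \<in> AS" by (auto simp: AS_def)
qed

lemma one_notin_AS: "1 \<notin> AS"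
proof
  assume "1 \<in> AS"
  then obtain b :: 'a where "b ^ 2 + b = 1" by (auto simp: AS_def)
  thus False using square_add_self_neq_1[of b] by simp
qed

lemma card_AS: "2 * card AS = 2 ^ n"
proof -
  have "card {c. c ^ 2 + c = b ^ 2 + b} = 2" for b :: 'a
  proof -
    have "c ^ 2 + c = b ^ 2 + b \<longleftrightarrow> c = b \<or> c = b + 1" for c
    proof -
      have "(c ^ 2 + c) + (b ^ 2 + b) = (c + b) * (c + (b + 1))"
        by (simp add: power2_eq_square algebra_simps)
      thus ?thesis by (metis add_eq_0_iff_eq mult_eq_0_iff)
    qed
    hence "{c. c ^ 2 + c = b ^ 2 + b} = {b, b + 1}" by auto
    thus ?thesis by simp
  qed
  from sum_equal_fibres[where h = "\<lambda>_. 1 :: nat", OF this]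
  show ?thesis by (simp add: AS_def card_UNIV_eq)
qed

text \<open>\<open>AS\<close> is an additive subgroup of index 2 without 1, so it and its translate
  by 1 partition the field.\<close>

lemma add_one_in_AS_iff: "x + 1 \<in> AS \<longleftrightarrow> x \<notin> AS"
proof -
  have inj: "inj_on (\<lambda>x. x + 1) AS" by (auto intro: inj_onI)
  have disj: "AS \<inter> (\<lambda>x. x + 1) ` AS = {}"
    using AS_add one_notin_AS by force
  have "card (AS \<union> (\<lambda>x. x + 1) ` AS) = CARD('a)"
    using card_AS by (simp add: card_Un_disjoint[OF _ _ disj] card_image[OF inj] card_UNIV_eq)
  hence "AS \<union> (\<lambda>x. x + 1) ` AS = UNIV"
    by (intro card_subset_eq) auto
  hence "x \<in> AS \<or> x \<in> (\<lambda>x. x + 1) ` AS" by blast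
  moreover have "x \<notin> AS" if "x + 1 \<in> AS"
    using AS_add[OF that, of x] one_notin_AS by (auto simp: ac_simps)
  ultimately show ?thesis by (auto simp: add.assoc)
qed

text \<open>\<open>AS\<close> is the kernel of the absolute trace, so this is the trace character.\<close>

definition chi :: "'a \<Rightarrow> int" where
  "chi x = (if x \<in> AS then 1 else - 1)"

lemma AS_add_iff: "x + y \<in> AS \<longleftrightarrow> (x \<in> AS \<longleftrightarrow> y \<in> AS)"
proof -
  have 1: "x + y \<in> AS \<longleftrightarrow> x \<in> AS" if "y \<in> AS" for x y
    using AS_add[OF _ that, of x] AS_add[OF _ that, of "x + y"] by (auto simp: add.assoc)
  have "x + y \<in> AS \<longleftrightarrow> x \<notin> AS" if "y \<notin> AS"
  proof -
    have "x + y = (x + 1) + (y + 1)" by (simp add: ac_simps)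
    moreover have "y + 1 \<in> AS" using that by (simp add: add_one_in_AS_iff)
    ultimately show ?thesis using 1[of "y + 1" "x + 1"] add_one_in_AS_iff[of x] by metis
  qed
  thus ?thesis using 1 by blast
qed

lemma chi_add: "chi (x + y) = chi x * chi y"
  by (simp add: chi_def AS_add_iff)

lemma chi_0: "chi 0 = 1" and chi_1: "chi 1 = - 1"
  using one_notin_AS AS_add_iff[of 0 0] by (auto simp: chi_def)

lemma chi_square: "chi (x ^ 2) = chi x"
proof -
  have "chi (x ^ 2 + x) = 1" by (simp add: chi_def AS_def)
  thus ?thesis unfolding chi_add by (auto simp: chi_def split: if_splits)
qed

lemma sum_chi: "(\<Sum>x\<in>UNIV. chi (a * x)) = (if a = 0 then 2 ^ n else 0)"
proof (cases "a = 0")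
  case False
  \<comment> \<open>The shift by \<open>1 / a\<close> multiplies every term by
    \<open>chi 1 = - 1\<close>, so the sum equals its own negative.\<close>
  have "(\<Sum>x\<in>UNIV. chi (a * x)) = (\<Sum>x\<in>UNIV. chi (a * (x + 1 / a)))"
    by (rule sum.reindex_bij_witness[of _ "\<lambda>x. x + 1 / a" "\<lambda>x. x + 1 / a"]) (auto simp: add.assoc)
  also have "\<dots> = - (\<Sum>x\<in>UNIV. chi (a * x))"
    using False by (simp add: distrib_left chi_add chi_1 sum_negf)
  finally show ?thesis using False by simp
qed (simp add: chi_0 card_UNIV_eq)

section \<open>Fibres of \<open>g\<close> and the set Delta\<close>

definition g :: "'a \<Rightarrow> 'a" where
  "g t = t ^ 6 + t ^ 5"

text \<open>Cancelling \<open>D = s + t\<close> from \<open>g s + g t = 0\<close> and dividing by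
  \<open>Q ^ 2\<close> gives \<open>D = z ^ 2 + z + 1\<close> with
  \<open>z = D ^ 2 / Q\<close>.\<close>

lemma g_collision:
  assumes "g s = g t" "s \<noteq> t"
  shows "s + t \<notin> AS"
proof -
  define D where "D = s + t"
  define Q where "Q = s ^ 2 + s * t + t ^ 2"
  define S where "S = s ^ 4 + s ^ 3 * t + s ^ 2 * t ^ 2 + s * t ^ 3 + t ^ 4"
  have "D * Q = s ^ 3 + t ^ 3"
    by (simp add: D_def Q_def algebra_simps eval_nat_numeral)
  hence "(D * Q) ^ 2 = s ^ 6 + t ^ 6"
    by (simp add: power2_add flip: power_mult)
  moreover have "D * S = s ^ 5 + t ^ 5"
    by (simp add: D_def S_def algebra_simps eval_nat_numeral)
  ultimately have "D * (D * Q ^ 2 + S) = g s + g t"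
    by (simp add: g_def distrib_left power2_eq_square ac_simps)
  moreover have "D \<noteq> 0" using assms(2) by (simp add: D_def add_eq_0_iff_eq)
  ultimately have "D * Q ^ 2 = S"
    using assms(1) by (simp add: add_eq_0_iff_eq)
  also have "\<dots> = Q ^ 2 + Q * D ^ 2 + D ^ 4"
    by (simp add: D_def Q_def S_def algebra_simps eval_nat_numeral)
  finally have *: "D * Q ^ 2 = Q ^ 2 + Q * D ^ 2 + D ^ 4" .
  have "Q \<noteq> 0"
    using norm_form_eq_0[of s t] assms(2) unfolding Q_def by metis
  have "D = D * Q ^ 2 / Q ^ 2" using \<open>Q \<noteq> 0\<close> by simp
  also have "\<dots> = ((D ^ 2 / Q) ^ 2 + D ^ 2 / Q) + 1"
    unfolding * using \<open>Q \<noteq> 0\<close>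
    by (simp add: add_divide_distrib power_divide power2_eq_square eval_nat_numeral ac_simps)
  finally have "D + 1 = (D ^ 2 / Q) ^ 2 + D ^ 2 / Q"
    by (metis add.assoc add_self add_0_right)
  hence "D + 1 \<in> AS" by (simp add: AS_def)
  thus ?thesis by (simp add: add_one_in_AS_iff D_def)
qed

text \<open>Apart from the factor \<open>x + y\<close>, the difference of two values is the norm
  form in \<open>A\<close> and \<open>B\<close>; their common vanishing leads to
  \<open>x ^ 2 + x + 1 = 0\<close>.\<close>

lemma inj_dickson5: "inj (\<lambda>x :: 'a. x ^ 5 + x ^ 3 + x)"
proof (rule injI, rule ccontr)
  fix x y :: 'a
  assume eq: "x ^ 5 + x ^ 3 + x = y ^ 5 + y ^ 3 + y" and "x \<noteq> y"
  define A where "A = x ^ 2 + y ^ 2 + 1"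
  define B where "B = x * y + 1"
  have "(x + y) * (A ^ 2 + A * B + B ^ 2) = (x ^ 5 + x ^ 3 + x) + (y ^ 5 + y ^ 3 + y)"
    by (simp add: A_def B_def algebra_simps eval_nat_numeral)
  hence *: "A ^ 2 + A * B + B ^ 2 = 0"
    unfolding eq using \<open>x \<noteq> y\<close> by (simp add: add_eq_0_iff_eq)
  have A: "A = 0" and B: "B = 0" using norm_form_eq_0[OF *] by simp_all
  have "(x + y) ^ 2 = 1" using A by (simp add: A_def power2_add add_eq_0_iff_eq)
  hence "x + y = 1" using square_eq_iff[of "x + y" 1] by simp
  hence "y = x + 1" by (metis add_self_left)
  hence "x ^ 2 + x + 1 = 0" using B by (simp add: B_def algebra_simps power2_eq_square)
  thus False using square_add_self_neq_1 by blast
qed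

lemma g_partner: "\<exists>s. s \<noteq> t \<and> g s = g t"
proof (cases "t = 1")
  case True
  thus ?thesis by (intro exI[of _ 0]) (simp add: g_def)
next
  case False
  have "surj (\<lambda>x :: 'a. x ^ 5 + x ^ 3 + x)"
    by (rule finite_UNIV_inj_surj[OF finite inj_dickson5])
  then obtain x where "1 / (t + 1) = x ^ 5 + x ^ 3 + x" by (rule surjE)
  hence x: "x ^ 5 + x ^ 3 + x = 1 / (t + 1)" ..
  define P where "P = x ^ 5 + x ^ 3 + x"
  have "t + 1 \<noteq> 0" using False by (simp add: add_eq_0_iff_eq)
  hence "P \<noteq> 0" using x by (simp add: P_def)
  hence "x \<noteq> 0" by (auto simp: P_def)
  have "t + 1 = 1 / P" using x by (simp add: P_def)
  hence "t = 1 + 1 / P" by (metis add_self_left add.commute)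
  hence t: "t = (1 + P) / P" using \<open>P \<noteq> 0\<close> by (simp add: field_simps)
  \<comment> \<open>As \<open>g (u / P) = u ^ 5 * (u + P) / P ^ 6\<close>, the numerator
    \<open>u = P + (1 + x) ^ 5\<close> matches that of \<open>t\<close> once
    \<open>1 + P = u * (1 + x)\<close>. For nonzero \<open>x\<close> this condition says exactly
    that \<open>P\<close> is the Dickson value at \<open>x\<close>.\<close>
  define s where "s = (P + (1 + x) ^ 5) / P"
  have pow5: "u ^ 5 = u ^ 4 * u" for u :: 'a
    by (simp add: eval_nat_numeral mult.assoc)
  have pow6: "u ^ 6 = u ^ 5 * u" for u :: 'a
    by (simp add: eval_nat_numeral mult.assoc)
  have "(1 + x) ^ 5 = 1 + x + x ^ 4 + x ^ 5"
    unfolding pow5 power4_add by (simp add: algebra_simps)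
  hence key: "1 + P = (P + (1 + x) ^ 5) * (1 + x)"
    by (simp add: P_def algebra_simps eval_nat_numeral)
  have g_div: "g (u / P) = u ^ 5 * (u + P) / P ^ 6" for u
    unfolding g_def power_divide pow6 using \<open>P \<noteq> 0\<close>
    by (simp add: distrib_left add_divide_distrib)
  have key5: "(1 + P) ^ 5 = (P + (1 + x) ^ 5) ^ 5 * (1 + x) ^ 5"
    unfolding key by (rule power_mult_distrib)
  have "P + (1 + x) ^ 5 + P = (1 + x) ^ 5" "1 + P + P = 1"
    by (simp_all add: ac_simps)
  hence "g s = g t"
    unfolding s_def t g_div key5 by simp
  moreover have "s \<noteq> t"
  proof
    assume "s = t"
    hence "(1 + x) ^ 5 = 1 ^ 5" using \<open>P \<noteq> 0\<close> by (simp add: s_def t add.commute)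
    hence "1 + x = 1" by (simp only: fifth_eq_iff)
    thus False using \<open>x \<noteq> 0\<close> by simp
  qed
  ultimately show ?thesis by blast
qed

lemma card_g_fibre: "card {s. g s = g t} = 2"
proof -
  obtain s where s: "s \<noteq> t" "g s = g t" using g_partner by blast
  \<comment> \<open>Three distinct points would have all pairwise sums outside \<open>AS\<close>,
    though the three sums add up to 0 and \<open>AS\<close> has index 2.\<close>
  have "r = s \<or> r = t" if "g r = g t" for r
  proof (rule ccontr)
    assume "\<not> (r = s \<or> r = t)"
    hence "r + s \<notin> AS" "r + t \<notin> AS" "s + t \<notin> AS"
      using g_collision s that by auto
    thus False by (auto simp: AS_add_iff)
  qed
  hence "{s. g s = g t} = {s, t}" using s by auto
  thus ?thesis using s by simp
qed

lemma kasami_delta_eq: "kasami_delta 2 b = g (b ^ 2 + b + 1)"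
proof -
  have pow13: "x ^ 13 = (x ^ 4) ^ 2 * x ^ 4 * x" for x :: 'a
    by (simp add: eval_nat_numeral mult.assoc)
  have pow5: "x ^ 5 = x ^ 4 * x" for x :: 'a
    by (simp add: eval_nat_numeral mult.assoc)
  have pow6: "x ^ 6 = x ^ 5 * x" for x :: 'a
    by (simp add: eval_nat_numeral mult.assoc)
  define c where "c = b ^ 4"
  have c: "(b ^ 2) ^ 4 = c ^ 2" by (simp add: c_def flip: power_mult)
  have "kasami_delta 2 b = c ^ 2 * c * b + (c ^ 2 + 1) * (c + 1) * (b + 1) + 1"
    unfolding kasami_delta_def kasami_2 pow13 power4_add power2_add c_def by simp
  also have "\<dots> = c ^ 2 * c + c ^ 2 * b + c ^ 2 + c * b + c + b"
    by (simp add: algebra_simps)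
  \<comment> \<open>With \<open>t = b ^ 2 + b + 1\<close> the factors are \<open>t ^ 4\<close>,
    \<open>t\<close> and \<open>t + 1\<close>.\<close>
  also have "\<dots> = (c ^ 2 + c + 1) * (b ^ 2 + b + 1) * (b ^ 2 + b)"
    by (simp add: c_def eval_nat_numeral algebra_simps)
  also have "\<dots> = g (b ^ 2 + b + 1)"
    unfolding g_def pow6 pow5 power4_add c by (simp add: c_def[symmetric] algebra_simps)
  finally show ?thesis .
qed

text \<open>The values \<open>b ^ 2 + b + 1\<close> fill the complement of \<open>AS\<close>, and
  every fibre of \<open>g\<close> meets that complement.\<close>

lemma kasami_Delta_eq: "kasami_Delta 2 = range g"
proof
  show "kasami_Delta 2 \<subseteq> range g"
    by (auto simp: kasami_Delta_def kasami_delta_eq)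
  have *: "g t \<in> kasami_Delta 2" if "t \<notin> AS" for t
  proof -
    from that have "t + 1 \<in> AS" by (simp add: add_one_in_AS_iff)
    then obtain b where "t + 1 = b ^ 2 + b" by (auto simp: AS_def)
    hence "t = b ^ 2 + b + 1" by (metis add.assoc add_self add_0_right)
    thus ?thesis unfolding kasami_Delta_def by (metis kasami_delta_eq rangeI)
  qed
  show "range g \<subseteq> kasami_Delta 2"
  proof safe
    fix t
    obtain s where s: "s \<noteq> t" "g s = g t" using g_partner by blast
    hence "s + t \<notin> AS" by (intro g_collision)
    hence "s \<notin> AS \<or> t \<notin> AS" by (auto simp: AS_add_iff)
    thus "g t \<in> kasami_Delta 2" using * s(2) by metis
  qed
qed

section \<open>Intersecting the Fermat cubic with a line\<close>

lemma fermat_cubic_unique: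
  fixes v1 v2 v3 x1 x2 x3 :: 'a
  assumes x: "x1 ^ 3 + x2 ^ 3 + x3 ^ 3 = 0" and v: "v1 ^ 3 + v2 ^ 3 + v3 ^ 3 = 0"
    and line: "v1 * x1 ^ 5 + v2 * x2 ^ 5 + v3 * x3 ^ 5 = 0"
    and nz: "x1 \<noteq> 0" "x2 \<noteq> 0" "x3 \<noteq> 0"
  shows "\<exists>k. v1 = k * x1 \<and> v2 = k * x2 \<and> v3 = k * x3"
proof -
  txt \<open>Parametrize the line as \<open>k X + s (0, x3 ^ 5, x2 ^ 5)\<close>.\<close>
  define k where "k = v1 / x1"
  define s where "s = (v2 + k * x2) / x3 ^ 5"
  have x1: "x1 ^ 3 = x2 ^ 3 + x3 ^ 3"
    using x by (simp only: add.assoc add_eq_0_iff_eq)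
  have v1: "v1 = k * x1" using nz by (simp add: k_def)
  have "v2 + k * x2 = s * x3 ^ 5" using nz by (simp add: s_def)
  hence v2: "v2 = k * x2 + s * x3 ^ 5" by (metis add_self_left add.commute)
  \<comment> \<open>Squaring the cubic equation shows that X itself lies on the line.\<close>
  have sq: "x1 ^ 3 * x1 ^ 3 = x2 ^ 3 * x2 ^ 3 + x3 ^ 3 * x3 ^ 3"
    using power2_add[of "x2 ^ 3" "x3 ^ 3"] unfolding x1 power2_eq_square .
  have p6: "u * u ^ 5 = u ^ 3 * u ^ 3" for u :: 'a
    by (simp add: eval_nat_numeral mult.assoc)
  have "x3 ^ 5 * (v3 + k * x3 + s * x2 ^ 5) =
      (v1 * x1 ^ 5 + v2 * x2 ^ 5 + v3 * x3 ^ 5)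
      + k * (x1 * x1 ^ 5 + x2 * x2 ^ 5 + x3 * x3 ^ 5)"
    unfolding v1 v2 by (simp add: algebra_simps)
  also have "\<dots> = 0" unfolding line p6 sq by simp
  finally have "v3 + (k * x3 + s * x2 ^ 5) = 0" using nz by (simp add: add.assoc)
  hence v3: "v3 = k * x3 + s * x2 ^ 5" by (simp only: add_eq_0_iff_eq)

  define p r where "p = x2 ^ 3" and "r = x3 ^ 3"
  \<comment> \<open>\<open>A\<close>, \<open>B\<close>, \<open>C\<close> are the coefficients of the
    cubic restricted to the line, after removal of the factor \<open>s\<close> belonging to
    X.\<close>
  define A where "A = x2 ^ 2 * x3 ^ 2 * (p + r)"
  define B where "B = x2 * x3 * (p ^ 3 + r ^ 3)"
  define C where "C = p ^ 5 + r ^ 5"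
  \<comment> \<open>\<open>U\<close> is chosen to satisfy
    \<open>A * C + B ^ 2 = U ^ 2 + U * B\<close>; multiplying the quadratic by \<open>A\<close> then
    yields the norm form in \<open>k * A + s * U\<close> and \<open>s * B\<close>.\<close>
  define U where "U = x2 * x3 * p * r * (p + r)"
  have cube_add: "(a + b) ^ 3 = a ^ 3 + a ^ 2 * b + a * b ^ 2 + b ^ 3" for a b :: 'a
    by (simp add: eval_nat_numeral algebra_simps)
  have A': "A = x2 ^ 2 * x3 ^ 5 + x3 ^ 2 * x2 ^ 5"
    by (simp add: A_def p_def r_def eval_nat_numeral algebra_simps)
  have B': "B = x2 * (x3 ^ 5) ^ 2 + x3 * (x2 ^ 5) ^ 2"
    by (simp add: B_def p_def r_def eval_nat_numeral algebra_simps)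
  have C': "C = (x3 ^ 5) ^ 3 + (x2 ^ 5) ^ 3"
    by (simp add: C_def p_def r_def add.commute flip: power_mult)
  have "s * (k ^ 2 * A + k * s * B + s ^ 2 * C) =
      (k * x2 + s * x3 ^ 5) ^ 3 + (k * x3 + s * x2 ^ 5) ^ 3 + k ^ 3 * (x2 ^ 3 + x3 ^ 3)"
    unfolding A' B' C' cube_add power_mult_distrib
    by (simp add: algebra_simps power2_eq_square power3_eq_cube)
  also have "\<dots> = v1 ^ 3 + v2 ^ 3 + v3 ^ 3"
    unfolding v1 v2 v3 power_mult_distrib x1 by (simp add: ac_simps)
  finally have s: "s * (k ^ 2 * A + k * s * B + s ^ 2 * C) = 0" by (simp add: v)

  have "(p + r) * (p ^ 5 + r ^ 5) + (p ^ 3 + r ^ 3) ^ 2 =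
      (p * r * (p + r)) ^ 2 + p * r * (p + r) * (p ^ 3 + r ^ 3)"
    by (simp add: eval_nat_numeral algebra_simps)
  hence "(x2 * x3) ^ 2 * ((p + r) * (p ^ 5 + r ^ 5) + (p ^ 3 + r ^ 3) ^ 2) =
      (x2 * x3) ^ 2 * ((p * r * (p + r)) ^ 2 + p * r * (p + r) * (p ^ 3 + r ^ 3))"
    by simp
  hence AC: "A * C + B ^ 2 = U ^ 2 + U * B"
    unfolding A_def B_def C_def U_def by (simp add: power2_eq_square algebra_simps)
  have "s = 0"
  proof (rule ccontr)
    assume "s \<noteq> 0"
    hence "A * (k ^ 2 * A + k * s * B + s ^ 2 * C) = 0" using s by simp
    moreover have "A * (k ^ 2 * A + k * s * B + s ^ 2 * C) =
        (k * A) ^ 2 + k * A * (s * B) + s ^ 2 * (A * C + B ^ 2) + (s * B) ^ 2"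
      by (simp add: power2_eq_square algebra_simps)
    moreover have "\<dots> = (k * A + s * U) ^ 2 + (k * A + s * U) * (s * B) + (s * B) ^ 2"
      unfolding AC power2_add by (simp add: power2_eq_square algebra_simps)
    ultimately have "(k * A + s * U) ^ 2 + (k * A + s * U) * (s * B) + (s * B) ^ 2 = 0" by simp
    hence "s * B = 0" by (rule norm_form_eq_0)
    hence "p ^ 3 = r ^ 3" using nz \<open>s \<noteq> 0\<close> by (simp add: B_def add_eq_0_iff_eq)
    hence "x2 ^ 3 = x3 ^ 3" by (simp only: cube_eq_iff p_def r_def)
    hence "x1 ^ 3 = 0" by (simp add: x1)
    thus False using nz by simp
  qed
  thus ?thesis using v1 v2 v3 by auto
qed

text \<open>Removes the restriction to nonzero coordinates: if one \<open>x\<close> coordinate is 0,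
  the other two agree, and the line equation makes them 0 as well.\<close>

lemma fermat_cubic_proportional:
  fixes v1 v2 v3 x1 x2 x3 :: 'a
  assumes x: "x1 ^ 3 + x2 ^ 3 + x3 ^ 3 = 0" and v: "v1 ^ 3 + v2 ^ 3 + v3 ^ 3 = 0"
    and line: "v1 * x1 ^ 5 + v2 * x2 ^ 5 + v3 * x3 ^ 5 = 0"
    and v_nz: "v1 \<noteq> 0" "v2 \<noteq> 0" "v3 \<noteq> 0" and x_nz: "(x1, x2, x3) \<noteq> (0, 0, 0)"
  shows "\<exists>k. v1 = k * x1 \<and> v2 = k * x2 \<and> v3 = k * x3"
proof -
  have *: "b = 0 \<and> c = 0"
    if "b ^ 3 + c ^ 3 = 0" "u ^ 3 + v ^ 3 + w ^ 3 = 0" "v * b ^ 5 + w * c ^ 5 = 0" "u \<noteq> 0"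
    for b c u v w :: 'a
  proof -
    have bc: "b = c" using that(1) by (simp add: add_eq_0_iff_eq cube_eq_iff)
    have "(v + w) * c ^ 5 = 0" using that(3) by (simp add: bc distrib_right)
    moreover have "v + w \<noteq> 0" using that(2,4) by (auto simp: add_eq_0_iff_eq add.assoc)
    ultimately show ?thesis using bc by simp
  qed
  have "x1 \<noteq> 0"
  proof
    assume "x1 = 0"
    with *[of x2 x3 v1 v2 v3] x v line v_nz x_nz show False by simp
  qed
  moreover have "x2 \<noteq> 0"
  proof
    assume "x2 = 0"
    with *[of x1 x3 v2 v1 v3] x v line v_nz x_nz show False by (simp add: ac_simps)
  qed
  moreover have "x3 \<noteq> 0"
  proof
    assume "x3 = 0"
    with *[of x1 x2 v3 v1 v2] x v line v_nz x_nz show False by (simp add: ac_simps)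
  qed
  ultimately show ?thesis using fermat_cubic_unique[OF x v line] by blast
qed

section \<open>Character sums\<close>

text \<open>Orthogonality: \<open>2 ^ n\<close> times the indicator of \<open>F p = 0\<close> is a
  sum of characters over \<open>m\<close>, and for fixed \<open>m\<close> the sum over triples
  factors.\<close>

lemma sum_over_kernel:
  fixes fa fb fc :: "'a \<Rightarrow> 'a" and h :: "'a \<Rightarrow> int"
  shows "2 ^ n * (\<Sum>(x, y, z)\<in>{(x, y, z) \<in> X \<times> X \<times> X. fa x + fb y + fc z = 0}. h x * h y * h z) =
    (\<Sum>m\<in>UNIV. (\<Sum>x\<in>X. chi (m * fa x) * h x) * (\<Sum>x\<in>X. chi (m * fb x) * h x)
      * (\<Sum>x\<in>X. chi (m * fc x) * h x))"
proof -
  define F where "F = (\<lambda>(x, y, z). fa x + fb y + fc z)"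
  define H where "H = (\<lambda>(x, y, z). h x * h y * h z)"
  have prod3: "(\<Sum>x\<in>X. a x) * (\<Sum>x\<in>X. b x) * (\<Sum>x\<in>X. c x)
      = (\<Sum>(x, y, z)\<in>X \<times> X \<times> X. a x * b y * c z)" for a b c :: "'a \<Rightarrow> int"
    by (simp add: mult.assoc flip: sum.cartesian_product sum_distrib_left sum_distrib_right)
  have "(\<Sum>(x, y, z)\<in>{(x, y, z) \<in> X \<times> X \<times> X. fa x + fb y + fc z = 0}. h x * h y * h z)
      = (\<Sum>p\<in>{p \<in> X \<times> X \<times> X. F p = 0}. H p)"
    by (rule sum.cong) (auto simp: F_def H_def)
  also have "\<dots> = (\<Sum>p\<in>X \<times> X \<times> X. if F p = 0 then H p else 0)"
    by (rule sum.inter_filter) simp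
  also have "2 ^ n * \<dots> = (\<Sum>p\<in>X \<times> X \<times> X. (\<Sum>m\<in>UNIV. chi (F p * m)) * H p)"
    unfolding sum_distrib_left by (rule sum.cong) (auto simp: sum_chi)
  also have "\<dots> = (\<Sum>m\<in>UNIV. \<Sum>p\<in>X \<times> X \<times> X. chi (F p * m) * H p)"
    unfolding sum_distrib_right by (rule sum.swap)
  also have "\<dots> = (\<Sum>m\<in>UNIV. (\<Sum>x\<in>X. chi (m * fa x) * h x) * (\<Sum>x\<in>X. chi (m * fb x) * h x)
      * (\<Sum>x\<in>X. chi (m * fc x) * h x))"
    unfolding prod3
    by (intro sum.cong refl) (auto simp: F_def H_def distrib_left chi_add ac_simps)
  finally show ?thesis .
qed

lemma sum_chi_bij:
  assumes "bij f"
  shows "(\<Sum>x\<in>UNIV. chi (a * f x)) = (if a = 0 then 2 ^ n else 0)"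
  using sum.reindex_bij_betw[OF assms, of "\<lambda>x. chi (a * x)"] by (simp add: sum_chi)

text \<open>Under the bijection \<open>x = m * t ^ 2\<close> the term \<open>m * x ^ 5\<close> is
  the square of \<open>m ^ 3 * t ^ 5\<close>, and \<open>chi\<close> ignores squaring.\<close>

lemma sum_chi_g:
  assumes "m \<noteq> 0"
  shows "(\<Sum>t\<in>UNIV. chi (m ^ 3 * g t)) = (\<Sum>x\<in>UNIV. chi (x ^ 3 + m * x ^ 5))"
proof -
  have "bij (\<lambda>t. m * t)"
    by (rule o_bij[of "\<lambda>t. t / m"]) (use assms in \<open>auto simp: fun_eq_iff\<close>)
  from bij_comp[OF bij_square this] have bij: "bij (\<lambda>t. m * t ^ 2)" by (simp add: comp_def)
  have "chi (m ^ 3 * g t) = chi ((m * t ^ 2) ^ 3 + m * (m * t ^ 2) ^ 5)" for t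
  proof -
    have "m * (m * t ^ 2) ^ 5 = (m ^ 3 * t ^ 5) ^ 2"
      by (simp add: power_mult_distrib eval_nat_numeral ac_simps)
    moreover have "(m * t ^ 2) ^ 3 = m ^ 3 * t ^ 6"
      by (simp add: power_mult_distrib flip: power_mult)
    ultimately show ?thesis by (simp add: g_def distrib_left chi_add chi_square)
  qed
  thus ?thesis
    using sum.reindex_bij_betw[OF bij, of "\<lambda>x. chi (x ^ 3 + m * x ^ 5)"] by simp
qed

text \<open>Summing \<open>K t\<close> over all \<open>t\<close> counts the common zeros of both
  equations. These are the multiples of \<open>(m1, m2, m3)\<close>, so the total equals
  \<open>K 0\<close> alone, and the equal values \<open>K t\<close> for \<open>t \<noteq> 0\<close>
  vanish.\<close>

lemma sum_chi_fermat_curve: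
  assumes nz: "m1 \<noteq> 0" "m2 \<noteq> 0" "m3 \<noteq> 0" and m: "m1 ^ 3 + m2 ^ 3 + m3 ^ 3 = 0"
  shows "(\<Sum>(x, y, z)\<in>{(x, y, z). m1 * x ^ 5 + m2 * y ^ 5 + m3 * z ^ 5 = 0}.
    chi (x ^ 3) * chi (y ^ 3) * chi (z ^ 3)) = 0"
proof -
  define S where "S = {(x, y, z). m1 * x ^ 5 + m2 * y ^ 5 + m3 * z ^ 5 = 0}"
  define C where "C = (\<lambda>(x, y, z). x ^ 3 + y ^ 3 + z ^ 3 :: 'a)"
  define K where "K = (\<lambda>t. \<Sum>p\<in>S. chi (C p * t ^ 3))"
  have K0: "K 0 = 2 ^ n * 2 ^ n"
  proof -
    have "2 ^ n * (\<Sum>(x, y, z)\<in>S. 1 * 1 * 1 :: int)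
        = (\<Sum>m\<in>UNIV. (\<Sum>x\<in>UNIV. chi (m * (m1 * x ^ 5)) * 1) * (\<Sum>x\<in>UNIV. chi (m * (m2 * x ^ 5)) * 1)
      * (\<Sum>x\<in>UNIV. chi (m * (m3 * x ^ 5)) * 1))"
      using sum_over_kernel[where X = UNIV and fa = "\<lambda>x. m1 * x ^ 5" and fb = "\<lambda>x. m2 * x ^ 5"
        and fc = "\<lambda>x. m3 * x ^ 5" and h = "\<lambda>_. 1"]
      by (simp add: S_def)
    \<comment> \<open>Fifth powers permute the field, so only the trivial character
      contributes.\<close>
    also have "\<dots> = (\<Sum>m\<in>(UNIV :: 'a set). if m = 0 then 2 ^ n * 2 ^ n * 2 ^ n else 0)"
    proof (rule sum.cong, goal_cases)
      case (2 m)
      have "(\<Sum>x\<in>UNIV. chi (m * (c * x ^ 5)) * 1) = (if m = 0 then 2 ^ n else 0)" if "c \<noteq> 0" for c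
        using sum_chi_bij[OF bij_fifth, of "m * c"] that by (simp add: mult.assoc)
      with nz show ?case by simp
    qed simp
    also have "\<dots> = 2 ^ n * (2 ^ n * 2 ^ n)" by simp
    finally show ?thesis by (simp add: K_def chi_0 case_prod_beta)
  qed
  \<comment> \<open>\<open>S\<close> is a cone and \<open>C\<close> is homogeneous of degree 3.\<close>
  have K1: "K t = K 1" if "t \<noteq> 0" for t
    unfolding K_def
  proof (rule sum.reindex_bij_witness[of _ "\<lambda>(x, y, z). (x / t, y / t, z / t)"
        "\<lambda>(x, y, z). (x * t, y * t, z * t)"], goal_cases)
    case (4 p)
    obtain x y z where p: "p = (x, y, z)" by (cases p)
    have "m1 * (x / t) ^ 5 + m2 * (y / t) ^ 5 + m3 * (z / t) ^ 5
        = (m1 * x ^ 5 + m2 * y ^ 5 + m3 * z ^ 5) / t ^ 5"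
      by (simp add: power_divide add_divide_distrib)
    with 4 show ?case by (simp add: S_def p)
  next
    case (2 p)
    obtain x y z where p: "p = (x, y, z)" by (cases p)
    have "m1 * (x * t) ^ 5 + m2 * (y * t) ^ 5 + m3 * (z * t) ^ 5
        = (m1 * x ^ 5 + m2 * y ^ 5 + m3 * z ^ 5) * t ^ 5"
      by (simp add: power_mult_distrib distrib_right)
    with 2 show ?case by (simp add: S_def p)
  next
    case (5 p)
    thus ?case by (cases p) (simp add: C_def power_mult_distrib distrib_right)
  qed (use that in auto)
  have Z: "{p \<in> S. C p = 0} = (\<lambda>s. (s * m1, s * m2, s * m3)) ` UNIV" (is "_ = ?f ` _")
  proof (intro equalityI subsetI)
    fix p assume p: "p \<in> {p \<in> S. C p = 0}"
    obtain x y z where xyz: "p = (x, y, z)" by (cases p)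
    show "p \<in> ?f ` UNIV"
    proof (cases "p = (0, 0, 0)")
      case True
      thus ?thesis by (intro image_eqI[of _ _ 0]) auto
    next
      case False
      have "m1 * x ^ 5 + m2 * y ^ 5 + m3 * z ^ 5 = 0" "x ^ 3 + y ^ 3 + z ^ 3 = 0"
        using p by (simp_all add: xyz S_def C_def)
      moreover have "(x, y, z) \<noteq> (0, 0, 0)" using False by (simp add: xyz)
      ultimately obtain k where k: "m1 = k * x" "m2 = k * y" "m3 = k * z"
        using fermat_cubic_proportional nz m by blast
      hence "k \<noteq> 0" using nz(1) by (metis mult_zero_left)
      thus ?thesis by (intro image_eqI[of _ _ "1 / k"]) (simp_all add: k xyz)
    qed
  next
    fix p assume "p \<in> ?f ` UNIV"
    then obtain s where p: "p = (s * m1, s * m2, s * m3)" by auto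
    have *: "u * (s * u) ^ 5 = s ^ 5 * (u ^ 3) ^ 2" for u
      by (simp add: power_mult_distrib eval_nat_numeral ac_simps)
    have "m1 * (s * m1) ^ 5 + m2 * (s * m2) ^ 5 + m3 * (s * m3) ^ 5
        = s ^ 5 * (m1 ^ 3 + m2 ^ 3 + m3 ^ 3) ^ 2"
      by (simp add: * power2_add distrib_left)
    moreover have "C p = s ^ 3 * (m1 ^ 3 + m2 ^ 3 + m3 ^ 3)"
      by (simp add: C_def p power_mult_distrib distrib_left)
    ultimately show "p \<in> {p \<in> S. C p = 0}" by (simp add: m S_def p)
  qed
  have cardZ: "card {p \<in> S. C p = 0} = 2 ^ n"
    unfolding Z using nz by (subst card_image) (auto intro!: injI simp: card_UNIV_eq)
  have "(\<Sum>t\<in>UNIV. K t) = (\<Sum>p\<in>S. \<Sum>t\<in>UNIV. chi (C p * t ^ 3))"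
    unfolding K_def by (rule sum.swap)
  also have "\<dots> = (\<Sum>p\<in>S. if C p = 0 then 2 ^ n else 0)"
    by (simp add: sum_chi_bij[OF bij_cube])
  also have "\<dots> = 2 ^ n * 2 ^ n"
    using cardZ by (simp add: sum.If_cases Int_def)
  finally have "(\<Sum>t\<in>UNIV. K t) = 2 ^ n * 2 ^ n" .
  moreover have "(\<Sum>t\<in>UNIV. K t) = K 0 + (\<Sum>t\<in>UNIV - {0}. K t)"
    by (rule sum.remove) auto
  moreover have "(\<Sum>t\<in>UNIV - {0}. K t) = (\<Sum>t\<in>UNIV - {0 :: 'a}. K 1)"
    by (intro sum.cong refl K1) simp
  ultimately have "int (card (UNIV - {0 :: 'a})) * K 1 = 0"
    unfolding K0 sum_constant by simp
  moreover have "card (UNIV - {0 :: 'a}) \<noteq> 0"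
  proof -
    have "1 \<in> UNIV - {0 :: 'a}" by simp
    thus ?thesis using card_0_eq[OF finite, of "UNIV - {0 :: 'a}"] by blast
  qed
  ultimately have "K 1 = 0" by simp
  thus ?thesis by (simp add: K_def S_def C_def chi_add case_prod_beta)
qed

section \<open>Counting the triples\<close>

text \<open>The factor 8 arises because each of three sums over the range of \<open>g\<close> is
  half a sum over the field.\<close>

lemma card_Delta_relations:
  fixes v1 v2 v3 :: 'a
  assumes v: "v1 \<noteq> 0" "v2 \<noteq> 0" "v3 \<noteq> 0" "v1 + v2 + v3 = 0"
  shows "8 * card {(x, y, z) \<in> kasami_Delta 2 \<times> kasami_Delta 2 \<times> kasami_Delta 2.
    v1 * x + v2 * y + v3 * z = 0} = 2 ^ n * 2 ^ n"
proof -
  define N where "N = card {(x, y, z) \<in> range g \<times> range g \<times> range g. v1 * x + v2 * y + v3 * z = 0}"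
  obtain m1 m2 m3 where m: "v1 = m1 ^ 3" "v2 = m2 ^ 3" "v3 = m3 ^ 3"
    using bij_is_surj[OF bij_cube] unfolding surj_def by blast
  have nz: "m1 \<noteq> 0" "m2 \<noteq> 0" "m3 \<noteq> 0" using v m by auto
  define W where "W = (\<lambda>a. \<Sum>t\<in>UNIV. chi (a * g t))"
  define V where "V = (\<lambda>a. \<Sum>x\<in>UNIV. chi (a * x ^ 5) * chi (x ^ 3))"
  have half: "2 * (\<Sum>x\<in>range g. chi (a * x)) = W a" for a
    using sum_equal_fibres[OF card_g_fibre, of "\<lambda>x. chi (a * x)"] by (simp add: W_def)
  have W: "W (a ^ 3) = V a" if "a \<noteq> 0" for a
    using sum_chi_g[OF that] by (simp add: W_def V_def chi_add mult.commute)
  have W0: "W 0 = 2 ^ n" by (simp add: W_def chi_0 card_UNIV_eq)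
  have V0: "V 0 = 0" using sum_chi_bij[OF bij_cube, of 1] by (simp add: V_def chi_0)
  have eight: "8 * (\<Sum>a\<in>UNIV. A a * B a * C a) = (\<Sum>a\<in>UNIV. (2 * A a) * (2 * B a) * (2 * C a))"
    for A B C :: "'a \<Rightarrow> int"
    by (simp add: sum_distrib_left mult.assoc)
  have N: "2 ^ n * int N = (\<Sum>a\<in>UNIV. (\<Sum>x\<in>range g. chi (a * (v1 * x)))
      * (\<Sum>x\<in>range g. chi (a * (v2 * x))) * (\<Sum>x\<in>range g. chi (a * (v3 * x))))"
    using sum_over_kernel[where X = "range g" and fa = "\<lambda>x. v1 * x" and fb = "\<lambda>x. v2 * x"
        and fc = "\<lambda>x. v3 * x" and h = "\<lambda>_. 1"]
    by (simp add: N_def case_prod_beta)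
  have "2 ^ n * (8 * int N) = 8 * (2 ^ n * int N)" by simp
  also have "\<dots> = (\<Sum>a\<in>UNIV. (2 * (\<Sum>x\<in>range g. chi (a * (v1 * x))))
      * (2 * (\<Sum>x\<in>range g. chi (a * (v2 * x)))) * (2 * (\<Sum>x\<in>range g. chi (a * (v3 * x)))))"
    unfolding N eight ..
  also have "\<dots> = (\<Sum>a\<in>UNIV. W (a * v1) * W (a * v2) * W (a * v3))"
    by (simp only: half flip: mult.assoc)
  \<comment> \<open>Cubing permutes the field; now each argument is a cube
    \<open>(a * m) ^ 3\<close>, as \<open>sum_chi_g\<close> requires.\<close>
  also have "\<dots> = (\<Sum>a\<in>UNIV. W (a ^ 3 * v1) * W (a ^ 3 * v2) * W (a ^ 3 * v3))"
    by (rule sum.reindex_bij_betw[OF bij_cube, symmetric])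
  \<comment> \<open>\<open>W\<close> and \<open>V\<close> disagree only at \<open>a = 0\<close>,
    where \<open>W 0 = 2 ^ n\<close> but \<open>V 0 = 0\<close>; this term is the entire
    count.\<close>
  also have "\<dots> = (\<Sum>a\<in>UNIV. (if a = 0 then 2 ^ n * 2 ^ n * 2 ^ n else 0)
      + V (a * m1) * V (a * m2) * V (a * m3))"
    using nz by (intro sum.cong) (auto simp: W0 V0 W m simp flip: power_mult_distrib)
  also have "\<dots> = 2 ^ n * 2 ^ n * 2 ^ n + (\<Sum>a\<in>UNIV. V (a * m1) * V (a * m2) * V (a * m3))"
    by (simp add: sum.distrib)
  also have "(\<Sum>a\<in>UNIV. V (a * m1) * V (a * m2) * V (a * m3)) = 0"
    using sum_over_kernel[where X = UNIV and fa = "\<lambda>x. m1 * x ^ 5" and fb = "\<lambda>x. m2 * x ^ 5"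
        and fc = "\<lambda>x. m3 * x ^ 5" and h = "\<lambda>x. chi (x ^ 3)"]
      sum_chi_fermat_curve[OF nz] v(4)
    by (simp add: V_def m mult.assoc)
  finally have "2 ^ n * (8 * int N) = 2 ^ n * (2 ^ n * 2 ^ n)" by simp
  hence "int (8 * N) = int (2 ^ n * 2 ^ n)" by simp
  hence "8 * N = 2 ^ n * 2 ^ n" by (simp only: of_nat_eq_iff)
  thus ?thesis by (simp add: N_def kasami_Delta_eq)
qed

section \<open>The polynomial in tau\<close>

lemma poly_tau_poly: "poly (tau_poly a b) t = (a * t ^ 5 + b) ^ 3 + (t ^ 3 + 1) ^ 5"
  for a b t :: 'a
  by (simp add: tau_poly_def poly_monom)

text \<open>The leading terms combine to \<open>a ^ 3 + 1\<close>, nonzero because cubing is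
  injective and \<open>a \<noteq> 1\<close>.\<close>

lemma degree_tau_poly:
  fixes a b :: 'a
  assumes "a \<noteq> 0" "a \<noteq> 1"
  shows "degree (tau_poly a b) = 15"
proof -
  define p where "p = monom a 5 + [:b:]"
  define q where "q = monom (1 :: 'a) 3 + 1"
  have p: "degree p = 5" "lead_coeff p = a"
  proof -
    show d: "degree p = 5" unfolding p_def
      by (subst degree_add_eq_left) (use assms in \<open>auto simp: degree_monom_eq\<close>)
    show "lead_coeff p = a" unfolding d by (simp add: p_def coeff_pCons split: nat.splits)
  qed
  have q: "degree q = 3" "lead_coeff q = 1"
  proof -
    show d: "degree q = 3" unfolding q_def
      by (subst degree_add_eq_left) (auto simp: degree_monom_eq)
    show "lead_coeff q = 1" unfolding d by (simp add: q_def)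
  qed
  have d: "degree (p ^ 3) = 15" "degree (q ^ 5) = 15"
    using p(1) q(1) degree_power_eq[of p 3] degree_power_eq[of q 5] by force+
  have "coeff (p ^ 3) 15 = a ^ 3" "coeff (q ^ 5) 15 = 1"
    using lead_coeff_power[of p 3] lead_coeff_power[of q 5] by (simp_all add: p(2) q(2) d)
  hence c: "coeff (tau_poly a b) 15 = a ^ 3 + 1" by (simp add: tau_poly_def p_def q_def)
  have "a ^ 3 + 1 \<noteq> 0" using assms cube_eq_iff[of a 1] by (simp add: add_eq_0_iff_eq)
  hence "degree (tau_poly a b) \<ge> 15" unfolding c[symmetric] by (rule le_degree)
  moreover have "degree (tau_poly a b) \<le> 15"
    unfolding tau_poly_def p_def[symmetric] q_def[symmetric]
    by (rule degree_add_le) (simp_all add: d)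
  ultimately show ?thesis by simp
qed

text \<open>A root \<open>t\<close> gives a point \<open>(t, 1, y)\<close> of the cubic on the curve
  with coefficients \<open>(a, b, 1)\<close>; proportionality of these triples forces
  \<open>t = a / b\<close>.\<close>

lemma tau_poly_roots:
  fixes a b :: 'a
  assumes nz: "a \<noteq> 0" "b \<noteq> 0" and ab: "a ^ 6 + b ^ 6 = 1"
  shows "{t. poly (tau_poly a b) t = 0} = {a / b}"
proof -
  have "(a ^ 3 + b ^ 3) ^ 2 = 1 ^ 2" using ab by (simp add: power2_add flip: power_mult)
  hence ab3: "a ^ 3 + b ^ 3 = 1" by (simp only: square_eq_iff)
  have "t = a / b" if "(a * t ^ 5 + b) ^ 3 + (t ^ 3 + 1) ^ 5 = 0" for t
  proof -
    have "surj (\<lambda>y :: 'a. y ^ 3)" using bij_cube by (rule bij_is_surj)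
    then obtain y where y: "t ^ 3 + 1 = y ^ 3" by (rule surjE)
    have "(a * t ^ 5 + b) ^ 3 = (y ^ 5) ^ 3"
      using that unfolding y by (simp add: add_eq_0_iff_eq flip: power_mult)
    hence "a * t ^ 5 + b = y ^ 5" by (simp only: cube_eq_iff)
    hence "\<exists>k. a = k * t \<and> b = k * 1 \<and> 1 = k * y"
      using nz ab3 y by (intro fermat_cubic_proportional) (auto simp: add_eq_0_iff_eq)
    thus ?thesis using nz by auto
  qed
  moreover have "(a * (a / b) ^ 5 + b) ^ 3 + ((a / b) ^ 3 + 1) ^ 5 = 0"
  proof -
    have "a * (a / b) ^ 5 + b = (a ^ 6 + b ^ 6) / b ^ 5"
      using nz by (simp add: field_simps eval_nat_numeral)
    moreover have "(a / b) ^ 3 + 1 = (a ^ 3 + b ^ 3) / b ^ 3"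
      using nz by (simp add: power_divide add_divide_distrib)
    ultimately show ?thesis by (simp add: ab ab3 power_divide flip: power_mult)
  qed
  ultimately show ?thesis unfolding poly_tau_poly by blast
qed

end

theorem theorem11p11:
  fixes n :: nat
  assumes "n > 0" and "gcd 2 n = 1"
    and "CARD('a :: {field, finite}) = 2 ^ n"
  shows "(\<forall>v1 v2 :: 'a. v1 \<noteq> 0 \<and> v2 \<noteq> 0 \<and> v1 \<noteq> v2 \<longrightarrow>
            card {(x, y, z) \<in> kasami_Delta 2 \<times> kasami_Delta 2 \<times> kasami_Delta 2.
                    v1 * x + v2 * y + (v1 + v2) * z = 0} = 2 ^ (2 * n - 3))
       \<and> (\<forall>a b :: 'a. a \<notin> {0, 1} \<and> b \<notin> {0, 1} \<and> a ^ 6 + b ^ 6 = 1 \<longrightarrow>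
            degree (tau_poly a b) = 15 \<and> {\<tau>. poly (tau_poly a b) \<tau> = 0} = {a / b})"
proof -
  have "odd n" using assms(2) by (metis coprime_iff_gcd_eq_1 coprime_left_2_iff_odd)
  then interpret odd_binary_field "TYPE('a)" n
    using assms(3) by unfold_locales
  show ?thesis
  proof (intro conjI allI impI)
    fix v1 v2 :: 'a
    assume v: "v1 \<noteq> 0 \<and> v2 \<noteq> 0 \<and> v1 \<noteq> v2"
    \<comment> \<open>Three distinct elements exclude \<open>n = 1\<close>, so the natural
      subtraction \<open>2 * n - 3\<close> does not truncate.\<close>
    have "card {0, v1, v2} \<le> CARD('a)" by (rule card_mono) auto
    hence "n \<noteq> 1" using v assms(3) by auto
    with \<open>odd n\<close> have n: "n \<ge> 3" by presburger
    define N where "N = card {(x, y, z) \<in> kasami_Delta 2 \<times> kasami_Delta 2 \<times> kasami_Delta 2.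
      v1 * x + v2 * y + (v1 + v2) * z = 0}"
    have "v1 + v2 \<noteq> 0" using v by (simp add: add_eq_0_iff_eq)
    hence "8 * N = 2 ^ n * 2 ^ n"
      unfolding N_def using v n by (intro card_Delta_relations) auto
    also have "\<dots> = 2 ^ (3 + (2 * n - 3))" using n by (simp flip: power_add mult_2)
    finally show "N = 2 ^ (2 * n - 3)" by (simp add: power_add)
  qed (auto simp: degree_tau_poly tau_poly_roots)
qed

end
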